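(* Let $Y$ and $X$ be the spatio-temporal processes defined in the context, and suppose that assumptions (A1) and (A2) stated there hold. Then, for all integers $h\ge 1$, $Y(s,h\,\delta t)$ and $X(s,h\,\delta t)$ are continuous in $s\in S$ with probability $1$.
   Context: $S\subset\mathbb{R}^2$ is a compact set containing a rectangle of positive area; $\|\cdot\|$ is the Euclidean norm. For $v=(v_1,v_2)\in\mathbb{R}^2$ write $v^2:=(v_1^2,v_2^2)$. For $s\in S$ define $M_s:=\exp\left(\max\{\|s^2-u^2\|^2: u\in S\}\right)$. Assumptions. (A1) $\{X(s,0)\}_{s\in S}$ and $\{Y(s,0)\}_{s\in S}$ are centered Gaussian processes with symmetric, positive definite covariance functions having bounded partial derivatives. (The particular choice made is squared exponential, $\operatorname{cov}(X(s_1,0),X(s_2,0))=\sigma_p^2\exp(-\eta_1\|s_1-s_2\|^2)$ and $\operatorname{cov}(Y(s_1,0),Y(s_2,0))=\sigma_\theta^2\exp(-\eta_2\|s_1-s_2\|^2)$, but for example Matérn covariances with smoothness $\nu>1$ are also allowed.) (A2) $V:\mathbb{R}\to\mathbb{R}$ is a zero-mean Gaussian random function with covariance function $c_v(x_1,x_2)=\sigma^2\exp(-\eta_3|x_1-x_2|^2)$; other covariance functions are also allowed, provided they are twice continuously differentiable with Lipschitz continuous mixed partial derivatives (for example rational quadratic, or Matérn with $\nu>2$). Here $\sigma_p,\sigma_\theta,\sigma,\eta_1,\eta_2,\eta_3>0$. $V'$ denotes the derivative of $V$. Dynamics. Fix $\delta t>0$ and real $\alpha,\beta$ with $|\alpha|<1$,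 $|\beta|<1$. For $s\in S$ and $t=h\,\delta t$, $h=0,1,2,\dots$, define recursively $$Y(s,t+\delta t)=\beta Y(s,t)+\frac{\delta t}{M_s}\left(\alpha X(s,t)-\frac{\delta t}{2}V'(Y(s,t))\right),$$ $$X(s,t+\delta t)=\alpha^2X(s,t)-\frac{\delta t}{2}\left\{\alpha V'(Y(s,t))+V'(Y(s,t+\delta t))\right\}.$$
   Formalization: The processes X(·,0), Y(·,0) on S and V on R are additionally assumed separable (in Doob's sense); without this, altering X(·,0) at an independent random point keeps (A1) but destroys continuity, and V' need not exist. *)

theory Defs
  imports "HOL-Probability.Probability"
begin

subsection \<open>Gaussian processes\<close>

text \<open>Degenerate (almost surely constant) variables count as Gaussian.\<close>

definition gaussian_rv :: "'w measure \<Rightarrow> ('w \<Rightarrow> real) \<Rightarrow> bool" where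
  "gaussian_rv M Z \<longleftrightarrow> Z \<in> borel_measurable M \<and>
     ((\<exists>\<mu> \<sigma>. 0 < \<sigma> \<and> distributed M lborel Z (\<lambda>x. ennreal (normal_density \<mu> \<sigma> x))) \<or>
      (\<exists>\<mu>. AE w in M. Z w = \<mu>))"

definition gaussian_process :: "'w measure \<Rightarrow> 'i set \<Rightarrow> ('i \<Rightarrow> 'w \<Rightarrow> real) \<Rightarrow> bool" where
  "gaussian_process M T Z \<longleftrightarrow>
     (\<forall>t\<in>T. Z t \<in> borel_measurable M) \<and>
     (\<forall>F a. finite F \<longrightarrow> F \<subseteq> T \<longrightarrow> gaussian_rv M (\<lambda>w. \<Sum>t\<in>F. a t * Z t w))"

definition covar :: "'w measure \<Rightarrow> ('w \<Rightarrow> real) \<Rightarrow> ('w \<Rightarrow> real) \<Rightarrow> real" where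
  "covar M A B = (LINT w|M. (A w - (LINT w|M. A w)) * (B w - (LINT w|M. B w)))"

definition centered_gaussian_process ::
    "'w measure \<Rightarrow> 'i set \<Rightarrow> ('i \<Rightarrow> 'w \<Rightarrow> real) \<Rightarrow> ('i \<Rightarrow> 'i \<Rightarrow> real) \<Rightarrow> bool" where
  "centered_gaussian_process M T Z K \<longleftrightarrow>
     gaussian_process M T Z \<and>
     (\<forall>t\<in>T. (LINT w|M. Z t w) = 0) \<and>
     (\<forall>s\<in>T. \<forall>t\<in>T. covar M (Z s) (Z t) = K s t)"

text \<open>
  Separability in the sense of Doob (for all closed sets).  Finite-dimensional distributions
  do not determine whether sample paths are continuous: changing a process at a random
  index leaves them unchanged and destroys continuity.  Sample path statements about
  Gaussian processes therefore refer to separable versions.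
\<close>

definition separable_process ::
    "'w measure \<Rightarrow> 'i::topological_space set \<Rightarrow> ('i \<Rightarrow> 'w \<Rightarrow> real) \<Rightarrow> bool" where
  "separable_process M T Z \<longleftrightarrow>
     (\<exists>D. countable D \<and> D \<subseteq> T \<and> T \<subseteq> closure D \<and>
        (AE w in M. \<forall>I C. open I \<longrightarrow> closed C \<longrightarrow>
           (\<forall>t\<in>I \<inter> D. Z t w \<in> C) \<longrightarrow> (\<forall>t\<in>I \<inter> T. Z t w \<in> C)))"

subsection \<open>Conditions on covariance functions\<close>

definition symmetric_on :: "'i set \<Rightarrow> ('i \<Rightarrow> 'i \<Rightarrow> real) \<Rightarrow> bool" where
  "symmetric_on T K \<longleftrightarrow> (\<forall>s\<in>T. \<forall>t\<in>T. K s t = K t s)"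

text \<open>
  Positive definiteness in the sense of positive definite functions, i.e. with a
  nonnegative quadratic form; strictly positive definite functions are a special case.
\<close>

definition positive_definite_on :: "'i set \<Rightarrow> ('i \<Rightarrow> 'i \<Rightarrow> real) \<Rightarrow> bool" where
  "positive_definite_on T K \<longleftrightarrow>
     (\<forall>F a. finite F \<longrightarrow> F \<subseteq> T \<longrightarrow> 0 \<le> (\<Sum>s\<in>F. \<Sum>t\<in>F. a s * a t * K s t))"

definition bounded_partials_on ::
    "(real^2) set \<Rightarrow> (real^2 \<Rightarrow> real^2 \<Rightarrow> real) \<Rightarrow> bool" where
  "bounded_partials_on U K \<longleftrightarrow>
     (\<exists>B. \<forall>s\<in>U. \<forall>u\<in>U. \<forall>i. \<exists>D1 D2.
        ((\<lambda>h. K (s + h *\<^sub>R axis i 1) u) has_real_derivative D1) (at 0) \<and> \<bar>D1\<bar> \<le> B \<and>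
        ((\<lambda>h. K s (u + h *\<^sub>R axis i 1)) has_real_derivative D2) (at 0) \<and> \<bar>D2\<bar> \<le> B)"

text \<open>
  The index set is an arbitrary compact set, on which partial derivatives need not make
  sense, so the covariance function is taken to be defined and differentiable near it.
\<close>

definition smooth_spatial_covariance ::
    "(real^2) set \<Rightarrow> (real^2 \<Rightarrow> real^2 \<Rightarrow> real) \<Rightarrow> bool" where
  "smooth_spatial_covariance S K \<longleftrightarrow>
     symmetric_on S K \<and> positive_definite_on S K \<and>
     (\<exists>U. open U \<and> S \<subseteq> U \<and> bounded_partials_on U K)"

definition pd1 :: "(real \<Rightarrow> real \<Rightarrow> real) \<Rightarrow> real \<Rightarrow> real \<Rightarrow> real" where
  "pd1 c x y = deriv (\<lambda>z. c z y) x"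

definition pd2 :: "(real \<Rightarrow> real \<Rightarrow> real) \<Rightarrow> real \<Rightarrow> real \<Rightarrow> real" where
  "pd2 c x y = deriv (\<lambda>z. c x z) y"

definition C1_plane :: "(real \<Rightarrow> real \<Rightarrow> real) \<Rightarrow> bool" where
  "C1_plane c \<longleftrightarrow>
     (\<forall>x y. (\<lambda>z. c z y) field_differentiable at x \<and> (\<lambda>z. c x z) field_differentiable at y) \<and>
     continuous_on UNIV (\<lambda>(x, y). pd1 c x y) \<and> continuous_on UNIV (\<lambda>(x, y). pd2 c x y)"

definition C2_plane :: "(real \<Rightarrow> real \<Rightarrow> real) \<Rightarrow> bool" where
  "C2_plane c \<longleftrightarrow> C1_plane c \<and> C1_plane (pd1 c) \<and> C1_plane (pd2 c)"

definition lipschitz_mixed_partials :: "(real \<Rightarrow> real \<Rightarrow> real) \<Rightarrow> bool" where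
  "lipschitz_mixed_partials c \<longleftrightarrow>
     (\<exists>L. L-lipschitz_on UNIV (\<lambda>(x, y). pd1 (pd2 c) x y)) \<and>
     (\<exists>L. L-lipschitz_on UNIV (\<lambda>(x, y). pd2 (pd1 c) x y))"

subsection \<open>Dynamics\<close>

definition sqv :: "real^2 \<Rightarrow> real^2" where
  "sqv v = (\<chi> i. (v $ i)\<^sup>2)"

text \<open>The supremum is a maximum for compact \<open>S\<close>.\<close>

definition Mfun :: "(real^2) set \<Rightarrow> real^2 \<Rightarrow> real" where
  "Mfun S s = exp (SUP u\<in>S. (norm (sqv s - sqv u))\<^sup>2)"

lemma Mfun_max:
  assumes "compact S" "S \<noteq> {}"
  shows "\<exists>u\<in>S. Mfun S s = exp ((norm (sqv s - sqv u))\<^sup>2) \<and>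
           (\<forall>u'\<in>S. (norm (sqv s - sqv u'))\<^sup>2 \<le> (norm (sqv s - sqv u))\<^sup>2)"
proof -
  have "continuous_on S (\<lambda>u. (norm (sqv s - sqv u))\<^sup>2)"
    unfolding sqv_def by (intro continuous_intros)
  from continuous_attains_sup[OF assms this] obtain u where u: "u \<in> S"
    "\<And>u'. u' \<in> S \<Longrightarrow> (norm (sqv s - sqv u'))\<^sup>2 \<le> (norm (sqv s - sqv u))\<^sup>2" by blast
  have "(SUP u\<in>S. (norm (sqv s - sqv u))\<^sup>2) = (norm (sqv s - sqv u))\<^sup>2"
    by (rule cSup_eq_maximum) (use u in auto)
  with u show ?thesis unfolding Mfun_def by auto
qed

text \<open>
  The second argument of \<open>X\<close> and \<open>Y\<close> is time; only the grid points \<open>h * dt\<close> are constrained.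
  \<open>V'\<close> is the pathwise derivative of \<open>V\<close>.
\<close>

definition dynamics ::
    "'w measure \<Rightarrow> (real^2) set \<Rightarrow> real \<Rightarrow> real \<Rightarrow> real \<Rightarrow> (real \<Rightarrow> 'w \<Rightarrow> real) \<Rightarrow>
     (real^2 \<Rightarrow> real \<Rightarrow> 'w \<Rightarrow> real) \<Rightarrow> (real^2 \<Rightarrow> real \<Rightarrow> 'w \<Rightarrow> real) \<Rightarrow> bool" where
  "dynamics M S dt \<alpha> \<beta> V X Y \<longleftrightarrow>
     (\<forall>w\<in>space M. \<forall>s\<in>S. \<forall>h::nat.
        let t = real h * dt; t' = real (Suc h) * dt; V' = deriv (\<lambda>x. V x w) in
        Y s t' w = \<beta> * Y s t w + dt / Mfun S s * (\<alpha> * X s t w - dt / 2 * V' (Y s t w)) \<and>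
        X s t' w = \<alpha>\<^sup>2 * X s t w - dt / 2 * (\<alpha> * V' (Y s t w) + V' (Y s t' w)))"

end

theory Submission
  imports Defs
begin

text \<open>
  Along a good sample point the recursion only composes continuous functions, so everything reduces
  to the almost sure continuity of \<open>X(\<cdot>, 0)\<close>, \<open>Y(\<cdot>, 0)\<close> and \<open>V'\<close>.  All three come from one chaining
  argument: a Gaussian process on a countable bounded planar index set whose increments have
  variance \<open>O(dist s t)\<close> has twelfth moments \<open>O(dist s t ^ 6)\<close>, which beats even the crude count
  \<open>O(16 ^ n)\<close> of all pairs of net points at scale \<open>2 ^ -n\<close>, so its paths are almost surely uniformly
  continuous; separability passes this on to the whole index set.  For the initial conditions the
  variance bound follows from the bounded partial derivatives.  For \<open>V\<close> the argument is applied to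
  the difference quotients \<open>(V(x + h) - V x) / h\<close>, indexed by \<open>(x, h)\<close> with \<open>h \<noteq> 0\<close>: the
  Lipschitz mixed partial gives the variance bound, and the continuous extension to \<open>h = 0\<close> is a
  continuous derivative.
\<close>

subsection \<open>Gaussian moments\<close>

text \<open>The factor is the double factorial (2k - 1)!!. Expressing it through the second moment
  instead of a parameter \<sigma> covers the degenerate case too: a centred constant is 0, and both
  sides are 1 for k = 0 and 0 otherwise.\<close>

lemma gaussian_rv_even_moment:
  assumes "prob_space M" and G: "gaussian_rv M Z" and Z0: "(LINT w|M. Z w) = 0"
  shows "integrable M (\<lambda>w. Z w ^ (2 * k))"
    and "(LINT w|M. Z w ^ (2 * k)) = fact (2 * k) / (2 ^ k * fact k) * (LINT w|M. (Z w)\<^sup>2) ^ k"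
proof -
  interpret prob_space M by fact
  have meas: "Z \<in> borel_measurable M" using G by (simp add: gaussian_rv_def)
  have "integrable M (\<lambda>w. Z w ^ (2 * k)) \<and>
    (LINT w|M. Z w ^ (2 * k)) = fact (2 * k) / (2 ^ k * fact k) * (LINT w|M. (Z w)\<^sup>2) ^ k"
  proof -
    consider (normal) \<mu> \<sigma> where "0 < \<sigma>" "distributed M lborel Z (\<lambda>x. ennreal (normal_density \<mu> \<sigma> x))"
      | (const) \<mu> where "AE w in M. Z w = \<mu>"
      using G unfolding gaussian_rv_def by blast
    then show ?thesis
    proof cases
      case normal
      have "\<mu> = 0" using normal_distributed_expectation[OF normal] Z0 by simp
      have hb: "has_bochner_integral lborel (\<lambda>x. normal_density 0 \<sigma> x * x ^ (2 * j))
          (fact (2 * j) / ((2 / \<sigma>\<^sup>2) ^ j * fact j))" for j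
        using normal_moment_even[of \<sigma> 0 j] normal(1) by simp
      have m: "integrable M (\<lambda>w. Z w ^ (2 * j))"
        "(LINT w|M. Z w ^ (2 * j)) = fact (2 * j) / ((2 / \<sigma>\<^sup>2) ^ j * fact j)" for j
        using hb[of j] normal(2) unfolding \<open>\<mu> = 0\<close>
        by (auto simp: distributed_integrable[OF normal(2), unfolded \<open>\<mu> = 0\<close>, where g = "\<lambda>x. x ^ (2 * j)"]
            distributed_integral[OF normal(2), unfolded \<open>\<mu> = 0\<close>, where g = "\<lambda>x. x ^ (2 * j)", symmetric]
            has_bochner_integral_iff)
      \<comment> \<open>The case j = 1 identifies the parameter, so that \<sigma> can be eliminated
        from the general formula.\<close>
      have "(LINT w|M. (Z w)\<^sup>2) = \<sigma>\<^sup>2"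
        using m(2)[of 1] by simp
      then show ?thesis using m[of k] by (simp add: power_divide field_simps)
    next
      case const
      have "(LINT w|M. Z w) = (LINT w|M. \<mu>)"
        by (intro integral_cong_AE) (use const meas in auto)
      then have "\<mu> = 0" using Z0 by (simp add: prob_space)
      then have z: "AE w in M. Z w = 0" using const by simp
      have i: "integrable M (\<lambda>w. Z w ^ j)" for j
        by (subst integrable_cong_AE[where g = "\<lambda>_. 0 ^ j"]) (use z meas in auto)
      have "(LINT w|M. Z w ^ j) = (LINT w|M. 0 ^ j)" for j
        by (intro integral_cong_AE) (use z meas in auto)
      then have e: "(LINT w|M. Z w ^ j) = 0 ^ j" for j by (simp add: prob_space)
      have "(LINT w|M. (Z w)\<^sup>2) = 0" using e[of 2] by simp
      with i e[of "2 * k"] show ?thesis by (cases "k = 0") (simp_all add: power_0_left)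
    qed
  qed
  then show "integrable M (\<lambda>w. Z w ^ (2 * k))"
    and "(LINT w|M. Z w ^ (2 * k)) = fact (2 * k) / (2 ^ k * fact k) * (LINT w|M. (Z w)\<^sup>2) ^ k"
    by auto
qed

text \<open>\<open>gaussian_process\<close> speaks of sums over sets of indices, but the points
  \<open>x i\<close> may coincide, as the nodes of two difference quotients can. Adding up the
  coefficients on each fibre of \<open>x\<close> bridges the gap.\<close>

lemma gaussian_process_lincomb:
  assumes "gaussian_process M T Z" "finite I" "\<And>i. i \<in> I \<Longrightarrow> x i \<in> T"
  shows "gaussian_rv M (\<lambda>w. \<Sum>i\<in>I. a i * Z (x i) w)"
proof -
  have "(\<Sum>i\<in>I. a i * Z (x i) w) = (\<Sum>t\<in>x ` I. (\<Sum>i\<in>{i \<in> I. x i = t}. a i) * Z t w)" for w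
    unfolding sum.image_gen[OF assms(2), of "\<lambda>i. a i * Z (x i) w" x] sum_distrib_right
    by (rule sum.cong[OF refl], rule sum.cong) auto
  moreover have "gaussian_rv M (\<lambda>w. \<Sum>t\<in>x ` I. (\<Sum>i\<in>{i \<in> I. x i = t}. a i) * Z t w)"
    using assms unfolding gaussian_process_def
    by (auto dest!: spec[of _ "x ` I"] spec[of _ "\<lambda>t. \<Sum>i\<in>{i \<in> I. x i = t}. a i"])
  ultimately show ?thesis by simp
qed

text \<open>With zero means, covariances are plain product moments, so the second moment of the
  combination is the quadratic form of \<open>K\<close>; being Gaussian, the combination has its
  other even moments determined by this one.\<close>

lemma centered_gaussian_process_lincomb:
  fixes a :: "'j \<Rightarrow> real"
  assumes "prob_space M" and Z: "centered_gaussian_process M T Z K"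
    and I: "finite I" "\<And>i. i \<in> I \<Longrightarrow> x i \<in> T"
  defines "f \<equiv> \<lambda>w. \<Sum>i\<in>I. a i * Z (x i) w"
  shows "integrable M (\<lambda>w. f w ^ (2 * k))"
    and "(LINT w|M. f w ^ (2 * k)) =
      fact (2 * k) / (2 ^ k * fact k) * (\<Sum>i\<in>I. \<Sum>j\<in>I. a i * a j * K (x i) (x j)) ^ k"
proof -
  interpret prob_space M by fact
  have gp: "gaussian_process M T Z" and mean: "\<And>t. t \<in> T \<Longrightarrow> (LINT w|M. Z t w) = 0"
    and cov: "\<And>s t. s \<in> T \<Longrightarrow> t \<in> T \<Longrightarrow> (LINT w|M. Z s w * Z t w) = K s t"
    using Z unfolding centered_gaussian_process_def covar_def by auto
  have meas: "\<And>t. t \<in> T \<Longrightarrow> Z t \<in> borel_measurable M"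
    using gp by (auto simp: gaussian_process_def)
  have g1: "gaussian_rv M (Z t)" if "t \<in> T" for t
    using gaussian_process_lincomb[OF gp, of "{t}" "\<lambda>x. x" "\<lambda>_. 1"] that by simp
  have sq: "integrable M (\<lambda>w. (Z t w)\<^sup>2)" if "t \<in> T" for t
    using gaussian_rv_even_moment(1)[OF assms(1) g1 mean, of t 1] that by simp
  have int1: "integrable M (Z t)" if "t \<in> T" for t
    using square_integrable_imp_integrable[OF meas sq] that by simp
  have int2: "integrable M (\<lambda>w. Z s w * Z t w)" if "s \<in> T" "t \<in> T" for s t
  proof (rule Bochner_Integration.integrable_bound)
    show "integrable M (\<lambda>w. (Z s w)\<^sup>2 + (Z t w)\<^sup>2)" using sq that by simp
    show "(\<lambda>w. Z s w * Z t w) \<in> borel_measurable M" using meas that by simp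
    have "\<bar>u * v\<bar> \<le> u\<^sup>2 + v\<^sup>2" for u v :: real
    proof -
      have "2 * (\<bar>u\<bar> * \<bar>v\<bar>) \<le> u\<^sup>2 + v\<^sup>2"
        using sum_squares_bound[of "\<bar>u\<bar>" "\<bar>v\<bar>"] by simp
      moreover have "0 \<le> \<bar>u\<bar> * \<bar>v\<bar>" by simp
      ultimately show ?thesis unfolding abs_mult by linarith
    qed
    then show "AE w in M. norm (Z s w * Z t w) \<le> norm ((Z s w)\<^sup>2 + (Z t w)\<^sup>2)"
      by simp
  qed
  have f: "gaussian_rv M f" unfolding f_def by (rule gaussian_process_lincomb[OF gp I])
  have f0: "(LINT w|M. f w) = 0"
    unfolding f_def using I int1 mean by (simp add: Bochner_Integration.integral_sum)
  have "(f w)\<^sup>2 = (\<Sum>i\<in>I. \<Sum>j\<in>I. (a i * a j) * (Z (x i) w * Z (x j) w))" for w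
    by (simp add: f_def power2_eq_square sum_product algebra_simps)
  then have "(LINT w|M. (f w)\<^sup>2) = (\<Sum>i\<in>I. \<Sum>j\<in>I. a i * a j * K (x i) (x j))"
    using I int2 cov by (simp add: Bochner_Integration.integral_sum)
  note * = gaussian_rv_even_moment[OF assms(1) f f0, of k, unfolded this]
  show "integrable M (\<lambda>w. f w ^ (2 * k))" by (rule *)
  show "(LINT w|M. f w ^ (2 * k)) =
      fact (2 * k) / (2 ^ k * fact k) * (\<Sum>i\<in>I. \<Sum>j\<in>I. a i * a j * K (x i) (x j)) ^ k"
    by (rule *)
qed

text \<open>The case k = 6. Later estimates control the modulus of the quadratic form, and the even
  power 6 removes the sign.\<close>

lemma gaussian_lincomb_moment_12:
  fixes a :: "'j \<Rightarrow> real"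
  assumes "prob_space M" "centered_gaussian_process M T Z K"
    and "finite I" "\<And>i. i \<in> I \<Longrightarrow> x i \<in> T"
    and v: "\<bar>\<Sum>i\<in>I. \<Sum>j\<in>I. a i * a j * K (x i) (x j)\<bar> \<le> b"
  shows "integrable M (\<lambda>w. (\<Sum>i\<in>I. a i * Z (x i) w) ^ 12)"
    and "(LINT w|M. (\<Sum>i\<in>I. a i * Z (x i) w) ^ 12) \<le> fact 12 / (2 ^ 6 * fact 6) * b ^ 6"
proof -
  note * = centered_gaussian_process_lincomb[OF assms(1-4), where k = 6 and a = a]
  show "integrable M (\<lambda>w. (\<Sum>i\<in>I. a i * Z (x i) w) ^ 12)" using *(1) by simp
  have "(\<Sum>i\<in>I. \<Sum>j\<in>I. a i * a j * K (x i) (x j)) ^ 6 \<le> b ^ 6"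
    using power_mono[OF v, of 6] by (simp add: power_even_abs)
  then have "fact 12 / (2 ^ 6 * fact 6) * (\<Sum>i\<in>I. \<Sum>j\<in>I. a i * a j * K (x i) (x j)) ^ 6
      \<le> fact 12 / (2 ^ 6 * fact 6) * b ^ 6"
    by (rule mult_left_mono) simp
  then show "(LINT w|M. (\<Sum>i\<in>I. a i * Z (x i) w) ^ 12) \<le> fact 12 / (2 ^ 6 * fact 6) * b ^ 6"
    using *(2) by simp
qed

subsection \<open>Chaining\<close>

text \<open>\<open>f\<close> and \<open>g\<close> act as two coordinates whose l1 distance dominates
  \<open>dist\<close>; this serves both \<open>real^2\<close> and pairs of reals. A square grid of
  mesh proportional to \<open>2 ^ -n\<close> meets the bounded image in O(\<open>4 ^ n\<close>)
  cells, and one point is kept per occupied cell.\<close>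

lemma planar_net:
  fixes f g :: "'a::metric_space \<Rightarrow> real"
  assumes d: "\<And>s t. s \<in> T \<Longrightarrow> t \<in> T \<Longrightarrow> dist s t \<le> \<bar>f s - f t\<bar> + \<bar>g s - g t\<bar>"
    and bd: "bounded (f ` T)" "bounded (g ` T)" and B: "0 < B"
  shows "\<exists>(A::nat) R. \<forall>n. R n \<subseteq> T \<and> finite (R n) \<and> card (R n) \<le> A * 4 ^ n \<and>
    (\<forall>t\<in>T. \<exists>p\<in>R n. dist t p \<le> B / 2 ^ n)"
proof -
  obtain N1 N2 where "\<forall>t\<in>T. \<bar>f t\<bar> \<le> N1" "\<forall>t\<in>T. \<bar>g t\<bar> \<le> N2"
    using bd unfolding bounded_iff by auto
  then obtain N where N: "\<And>t. t \<in> T \<Longrightarrow> \<bar>f t\<bar> \<le> N" "\<And>t. t \<in> T \<Longrightarrow> \<bar>g t\<bar> \<le> N"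
    by (metis max.coboundedI1 max.coboundedI2)
  \<comment> \<open>\<open>m\<close> bounds the cell numbers at scale 0 and \<open>c n\<close> is
    the inverse side length: cells have side \<open>B / 2 ^ n / 2\<close>, since each of the two
    coordinates contributes half of the allowed distance.\<close>
  define m where "m = nat \<lceil>N * 2 / B\<rceil>"
  define c where "c n = 2 ^ n * 2 / B" for n :: nat
  define cell where "cell n t = (\<lfloor>f t * c n\<rfloor>, \<lfloor>g t * c n\<rfloor>)" for n t
  \<comment> \<open>Choosing preimages keeps the net inside \<open>T\<close>, where the process is
    defined; cell centres need not lie there.\<close>
  define R where "R n = inv_into T (cell n) ` (cell n ` T)" for n
  define J where "J n = {- int (m * 2 ^ n) .. int (m * 2 ^ n)}" for n
  have c0: "c n > 0" for n using B by (simp add: c_def)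
  have fl: "\<lfloor>y * c n\<rfloor> \<in> J n" if "\<bar>y\<bar> \<le> N" for y n
  proof -
    have "N * 2 / B \<le> real m" unfolding m_def by linarith
    then have "N * c n \<le> real m * 2 ^ n"
      using mult_right_mono[of "N * 2 / B" "real m" "2 ^ n"] by (simp add: c_def field_simps)
    moreover have "\<bar>y * c n\<bar> \<le> N * c n"
      using that c0[of n] by (simp add: abs_mult mult_right_mono)
    ultimately have "\<bar>y * c n\<bar> \<le> of_int (int (m * 2 ^ n))" by simp
    then show ?thesis unfolding J_def atLeastAtMost_iff by linarith
  qed
  have sub: "cell n ` T \<subseteq> J n \<times> J n" for n
    using N fl by (auto simp: cell_def)
  have finc: "finite (cell n ` T)" for n
    by (rule finite_subset[OF sub]) (auto simp: J_def)
  have "card (R n) \<le> (2 * m + 1)\<^sup>2 * 4 ^ n" for n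
  proof -
    have "card (R n) \<le> card (cell n ` T)" unfolding R_def by (rule card_image_le[OF finc])
    also have "\<dots> \<le> card (J n \<times> J n)" by (rule card_mono[OF _ sub]) (auto simp: J_def)
    also have "\<dots> = (2 * m * 2 ^ n + 1)\<^sup>2"
      by (simp add: J_def card_cartesian_product power2_eq_square nat_add_distrib nat_mult_distrib nat_power_eq algebra_simps)
    also have "\<dots> \<le> ((2 * m + 1) * 2 ^ n)\<^sup>2"
      by (intro power_mono) (auto simp: algebra_simps)
    also have "\<dots> = (2 * m + 1)\<^sup>2 * 4 ^ n"
      by (simp only: power_mult_distrib power_mult[symmetric] mult.commute[of n 2]) (simp add: power_mult)
    finally show ?thesis .
  qed
  moreover have "\<exists>p\<in>R n. dist t p \<le> B / 2 ^ n" if t: "t \<in> T" for n t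
  proof -
    define p where "p = inv_into T (cell n) (cell n t)"
    have p: "p \<in> T" "cell n p = cell n t"
      unfolding p_def using t by (auto intro: inv_into_into f_inv_into_f)
    have "\<bar>y - z\<bar> \<le> 1 / c n" if "\<lfloor>y * c n\<rfloor> = \<lfloor>z * c n\<rfloor>" for y z
    proof -
      have "\<bar>y * c n - z * c n\<bar> \<le> 1" using that by linarith
      then have "\<bar>y - z\<bar> * c n \<le> 1" using c0[of n] by (simp add: abs_mult flip: left_diff_distrib)
      then show ?thesis using c0[of n] by (simp add: field_simps)
    qed
    then have "dist t p \<le> 1 / c n + 1 / c n"
      using d[OF t p(1)] p(2) unfolding cell_def
      by (smt (verit) prod.inject)
    also have "\<dots> = B / 2 ^ n" by (simp add: c_def)
    finally show ?thesis using t unfolding R_def p_def by auto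
  qed
  moreover have "R n \<subseteq> T" for n unfolding R_def by (auto intro: inv_into_into)
  moreover have "finite (R n)" for n unfolding R_def using finc by simp
  ultimately show ?thesis by (intro exI[of _ "(2 * m + 1)\<^sup>2"] exI[of _ R]) blast
qed

text \<open>The deterministic half of chaining. Each point is joined to its level \<open>n\<close>
  neighbour through ever finer nets, with increments summing to a geometric series. By
  \<open>ex\<close> the chain reaches the point itself after finitely many steps, so no prior
  continuity of \<open>f\<close> enters.\<close>

lemma chaining_uniformly_continuous:
  fixes f :: "'a::metric_space \<Rightarrow> real"
  assumes R: "\<And>n. R n \<subseteq> T" "\<And>n t. t \<in> T \<Longrightarrow> \<exists>p\<in>R n. dist t p \<le> B / 2 ^ n"
    and ex: "\<And>t. t \<in> T \<Longrightarrow> \<exists>m. \<forall>n\<ge>m. t \<in> R n"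
    and B: "0 < B" and q: "0 \<le> q" "q < 1"
    and inc: "\<And>n a b. n \<ge> n0 \<Longrightarrow> a \<in> R n \<union> R (Suc n) \<Longrightarrow> b \<in> R n \<union> R (Suc n) \<Longrightarrow>
      dist a b \<le> 4 * B / 2 ^ n \<Longrightarrow> \<bar>f a - f b\<bar> \<le> q ^ n"
  shows "uniformly_continuous_on T f"
proof -
  \<comment> \<open>Projection to the net; it fixes points that already belong to
    \<open>R n\<close>, which is what makes chains end exactly at \<open>t\<close>.\<close>
  define \<pi> where "\<pi> n t = (if t \<in> R n then t else SOME p. p \<in> R n \<and> dist t p \<le> B / 2 ^ n)" for n t
  have \<pi>: "\<pi> n t \<in> R n" "dist t (\<pi> n t) \<le> B / 2 ^ n" if "t \<in> T" for n t
  proof -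
    have "\<exists>p. p \<in> R n \<and> dist t p \<le> B / 2 ^ n" using R(2)[OF that] by blast
    from someI_ex[OF this] show "\<pi> n t \<in> R n" "dist t (\<pi> n t) \<le> B / 2 ^ n"
      using B by (auto simp: \<pi>_def)
  qed
  have tail: "\<bar>f t - f (\<pi> n t)\<bar> \<le> q ^ n / (1 - q)" if t: "t \<in> T" and n: "n \<ge> n0" for n t
  proof -
    obtain m where m: "\<forall>k\<ge>m. t \<in> R k" using ex[OF t] by blast
    \<comment> \<open>From level \<open>m'\<close> on, the projection of \<open>t\<close> is
      \<open>t\<close>; telescoping from \<open>n\<close> to \<open>m'\<close> gives the tail
      bound.\<close>
    define m' where "m' = max m n"
    have step: "\<bar>f (\<pi> (Suc k) t) - f (\<pi> k t)\<bar> \<le> q ^ k" if "k \<ge> n" for k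
    proof (rule inc)
      have "dist (\<pi> (Suc k) t) (\<pi> k t) \<le> dist t (\<pi> (Suc k) t) + dist t (\<pi> k t)"
        by (metis dist_commute dist_triangle2)
      also have "\<dots> \<le> B / 2 ^ Suc k + B / 2 ^ k"
        by (intro add_mono \<pi> t)
      also have "\<dots> \<le> 4 * B / 2 ^ k" using B by (simp add: field_simps)
      finally show "dist (\<pi> (Suc k) t) (\<pi> k t) \<le> 4 * B / 2 ^ k" .
    qed (use that n \<pi>[OF t] in auto)
    have "\<bar>f (\<pi> (n + j) t) - f (\<pi> n t)\<bar> \<le> q ^ n * (\<Sum>i<j. q ^ i)" for j
    proof (induction j)
      case (Suc j)
      then show ?case using step[of "n + j"] by (simp add: distrib_left power_add)
    qed simp
    also have "q ^ n * (\<Sum>i<j. q ^ i) \<le> q ^ n * (1 / (1 - q))" for j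
    proof (rule mult_left_mono)
      have "(\<Sum>i<j. q ^ i) = (1 - q ^ j) / (1 - q)" using q by (subst sum_gp_strict) auto
      also have "\<dots> \<le> 1 / (1 - q)" using q by (intro divide_right_mono) auto
      finally show "(\<Sum>i<j. q ^ i) \<le> 1 / (1 - q)" .
    qed (use q in auto)
    finally have "\<bar>f (\<pi> (n + (m' - n)) t) - f (\<pi> n t)\<bar> \<le> q ^ n / (1 - q)" by simp
    moreover have "\<pi> (n + (m' - n)) t = t" using m by (auto simp: \<pi>_def m'_def)
    ultimately show ?thesis by simp
  qed
  show ?thesis
    unfolding uniformly_continuous_on_def
  proof (intro allI impI)
    fix e :: real assume e: "0 < e"
    \<comment> \<open>Two points are compared through their level \<open>n\<close> projections: one
      increment between these costs \<open>q ^ n\<close>, and each of the two tails costs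
      \<open>q ^ n / (1 - q)\<close>.\<close>
    have "(\<lambda>n. q ^ n * (1 + 2 / (1 - q))) \<longlonglongrightarrow> 0 * (1 + 2 / (1 - q))"
      by (intro tendsto_mult LIMSEQ_realpow_zero) (use q in auto)
    then have "\<forall>\<^sub>F n in sequentially. q ^ n * (1 + 2 / (1 - q)) < e"
      using e by (auto dest: order_tendstoD)
    then obtain n' where "\<And>n. n \<ge> n' \<Longrightarrow> q ^ n * (1 + 2 / (1 - q)) < e"
      unfolding eventually_sequentially by blast
    then obtain n where n: "n \<ge> n0" "q ^ n * (1 + 2 / (1 - q)) < e"
      using max.cobounded1 max.cobounded2 by blast
    have "\<bar>f s - f t\<bar> < e" if st: "s \<in> T" "t \<in> T" "dist s t < B / 2 ^ n" for s t
    proof -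
      have "dist (\<pi> n s) (\<pi> n t) \<le> dist s (\<pi> n s) + dist s t + dist t (\<pi> n t)"
        using dist_triangle[of "\<pi> n s" "\<pi> n t" s] dist_triangle[of s "\<pi> n t" t]
        by (simp add: dist_commute)
      also have "\<dots> \<le> B / 2 ^ n + B / 2 ^ n + B / 2 ^ n"
        by (intro add_mono \<pi> st less_imp_le)
      also have "\<dots> \<le> 4 * B / 2 ^ n" using B by (simp add: field_simps)
      finally have "\<bar>f (\<pi> n s) - f (\<pi> n t)\<bar> \<le> q ^ n"
        using \<pi> st n by (intro inc) auto
      with tail[of s n] tail[of t n] st n have "\<bar>f s - f t\<bar> \<le> q ^ n + q ^ n / (1 - q) + q ^ n / (1 - q)"
        by linarith
      also have "\<dots> = q ^ n * (1 + 2 / (1 - q))" by (simp add: algebra_simps)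
      finally show ?thesis using n by simp
    qed
    then show "\<exists>d>0. \<forall>x\<in>T. \<forall>x'\<in>T. dist x' x < d \<longrightarrow> dist (f x') (f x) < e"
      using B by (intro exI[of _ "B / 2 ^ n"]) (auto simp: dist_real_def)
  qed
qed

text \<open>A Kolmogorov continuity criterion. At scale \<open>n\<close> there are
  O(\<open>16 ^ n\<close>) pairs, each with moment O(\<open>64 ^ -n\<close>); asking for increments
  at most \<open>q ^ n\<close> costs a factor \<open>q ^ (- 12 n)\<close>. The failure probabilities
  are then summable and Borel-Cantelli feeds the deterministic chaining lemma.\<close>

lemma kolmogorov_uniformly_continuous:
  fixes Z :: "'a::metric_space \<Rightarrow> 'w \<Rightarrow> real" and f g :: "'a \<Rightarrow> real"
  assumes M: "prob_space M" and T: "countable T"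
    and d: "\<And>s t. s \<in> T \<Longrightarrow> t \<in> T \<Longrightarrow> dist s t \<le> \<bar>f s - f t\<bar> + \<bar>g s - g t\<bar>"
    and bd: "bounded (f ` T)" "bounded (g ` T)"
    and r: "0 < r" and C: "0 \<le> C"
    and int: "\<And>s t. s \<in> T \<Longrightarrow> t \<in> T \<Longrightarrow> dist s t < r \<Longrightarrow> integrable M (\<lambda>w. (Z s w - Z t w) ^ 12)"
    and mom: "\<And>s t. s \<in> T \<Longrightarrow> t \<in> T \<Longrightarrow> dist s t < r \<Longrightarrow>
      (LINT w|M. (Z s w - Z t w) ^ 12) \<le> C * dist s t ^ 6"
  shows "AE w in M. uniformly_continuous_on T (\<lambda>t. Z t w)"
proof (cases "T = {}")
  case True
  then show ?thesis by (simp add: uniformly_continuous_on_def)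
next
  case False
  interpret prob_space M by fact
  \<comment> \<open>Makes \<open>4 * B < r\<close>, so that all pairs compared, already at scale 0,
    fall in the range of the moment bound.\<close>
  define B where "B = r / 5"
  have B: "0 < B" using r by (simp add: B_def)
  \<comment> \<open>The chain needs \<open>q < 1\<close>, while summability needs
    \<open>4 * q ^ 12 > 1\<close>; 9/10 satisfies both.\<close>
  define q :: real where "q = 9 / 10"
  obtain A :: nat and R0 where R0: "\<And>n. R0 n \<subseteq> T" "\<And>n. finite (R0 n)"
    "\<And>n. card (R0 n) \<le> A * 4 ^ n" "\<And>n t. t \<in> T \<Longrightarrow> \<exists>p\<in>R0 n. dist t p \<le> B / 2 ^ n"
    using planar_net[of T f g B, OF d bd B] by metis
  \<comment> \<open>Adding an enumeration puts every point into all late nets, so that the chains terminate.\<close>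
  define R where "R n = R0 n \<union> from_nat_into T ` {..n}" for n
  have R: "R n \<subseteq> T" "finite (R n)" for n
    using R0 from_nat_into[OF False] by (auto simp: R_def)
  have net: "\<exists>p\<in>R n. dist t p \<le> B / 2 ^ n" if "t \<in> T" for n t
    using R0(4)[OF that, of n] unfolding R_def by blast
  have ex: "\<exists>m. \<forall>n\<ge>m. t \<in> R n" if t: "t \<in> T" for t
  proof -
    obtain m where m: "from_nat_into T m = t"
      using from_nat_into_surj[OF T t] by blast
    have "t \<in> R n" if "n \<ge> m" for n
      unfolding R_def using that m[symmetric] by (intro UnI2 image_eqI[of _ _ m]) auto
    then show ?thesis by blast
  qed
  have cardR: "card (R n) \<le> (A + 1) * 4 ^ n" for n
  proof -
    have "card (R n) \<le> A * 4 ^ n + card (from_nat_into T ` {..n})"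
      unfolding R_def using card_Un_le[of "R0 n"] R0(3)[of n] by (meson add_right_mono le_trans)
    also have "card (from_nat_into T ` {..n}) \<le> Suc n"
      using card_image_le[of "{..n}" "from_nat_into T"] by simp
    also have "Suc n \<le> 4 ^ n" by (induction n) auto
    finally show ?thesis by simp
  qed
  define Q where "Q n = R n \<union> R (Suc n)" for n
  define P where "P n = {(a, b) \<in> Q n \<times> Q n. dist a b \<le> 4 * B / 2 ^ n}" for n
  have Q: "Q n \<subseteq> T" "finite (Q n)" for n using R by (auto simp: Q_def)
  have P: "finite (P n)" for n
    by (rule finite_subset[of _ "Q n \<times> Q n"]) (auto simp: P_def Q)
  have PT: "a \<in> T" "b \<in> T" "dist a b < r" if "(a, b) \<in> P n" for a b n
  proof -
    have "dist a b \<le> 4 * B / 2 ^ n" using that by (auto simp: P_def)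
    also have "\<dots> \<le> 4 * B" using B by (simp add: field_simps)
    also have "\<dots> < r" using r by (simp add: B_def)
    finally show "dist a b < r" .
    show "a \<in> T" "b \<in> T" using that Q by (auto simp: P_def)
  qed
  have cardP: "real (card (P n)) \<le> 25 * (real A + 1)\<^sup>2 * 16 ^ n" for n
  proof -
    have "card (Q n) \<le> card (R n) + card (R (Suc n))" unfolding Q_def by (rule card_Un_le)
    also have "\<dots> \<le> (A + 1) * 4 ^ n + (A + 1) * 4 ^ Suc n" by (intro add_mono cardR)
    also have "\<dots> = 5 * (A + 1) * 4 ^ n" by (simp add: algebra_simps)
    finally have "card (Q n) * card (Q n) \<le> (5 * (A + 1) * 4 ^ n) * (5 * (A + 1) * 4 ^ n)"
      by (intro mult_mono) auto
    moreover have "card (P n) \<le> card (Q n \<times> Q n)"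
      by (rule card_mono) (auto simp: P_def Q)
    ultimately have "card (P n) \<le> (5 * (A + 1) * 4 ^ n) * (5 * (A + 1) * 4 ^ n)"
      by (simp add: card_cartesian_product)
    then have "real (card (P n)) \<le> real ((5 * (A + 1) * 4 ^ n) * (5 * (A + 1) * 4 ^ n))"
      by (simp only: of_nat_le_iff)
    also have "\<dots> = 25 * (real A + 1)\<^sup>2 * (4 ^ n * 4 ^ n)"
      by (simp add: power2_eq_square algebra_simps)
    also have "(4::real) ^ n * 4 ^ n = 16 ^ n" by (simp flip: power_mult_distrib)
    finally show ?thesis .
  qed
  \<comment> \<open>All summands are nonnegative, so \<open>G n w < 1\<close> forces every increment
    at scale \<open>n\<close> below \<open>q ^ n\<close>. One Markov inequality for
    \<open>G n\<close> thus replaces a union bound over pairs.\<close>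
  define G where "G n w = (\<Sum>(a, b)\<in>P n. (Z a w - Z b w) ^ 12 / q ^ (12 * n))" for n w
  have Gint: "integrable M (G n)" for n
    unfolding G_def using PT by (auto intro!: Bochner_Integration.integrable_sum integrable_divide int)
  have Gpos: "0 \<le> G n w" for n w
    unfolding G_def q_def by (auto intro!: sum_nonneg zero_le_even_power divide_nonneg_nonneg)
  define K where "K = 25 * (real A + 1)\<^sup>2 * C * (4 * B) ^ 6"
  define \<rho> where "\<rho> = 1 / (4 * q ^ 12)"
  have \<rho>: "0 \<le> \<rho>" "\<rho> < 1" by (auto simp: \<rho>_def q_def eval_nat_numeral)
  have GE: "(LINT w|M. G n w) \<le> K * \<rho> ^ n" for n
  proof -
    have "(LINT w|M. G n w) = (\<Sum>(a, b)\<in>P n. (LINT w|M. (Z a w - Z b w) ^ 12) / q ^ (12 * n))"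
      unfolding G_def using PT
      by (subst Bochner_Integration.integral_sum)
        (auto intro!: integrable_divide int sum.cong simp: case_prod_unfold)
    also have "\<dots> \<le> (\<Sum>(a, b)\<in>P n. C * (4 * B / 2 ^ n) ^ 6 / q ^ (12 * n))"
    proof (rule sum_mono, clarify)
      fix a b assume ab: "(a, b) \<in> P n"
      have "(LINT w|M. (Z a w - Z b w) ^ 12) \<le> C * dist a b ^ 6"
        using PT[OF ab] by (rule mom)
      also have "\<dots> \<le> C * (4 * B / 2 ^ n) ^ 6"
        using ab C by (intro mult_left_mono power_mono) (auto simp: P_def)
      finally show "(LINT w|M. (Z a w - Z b w) ^ 12) / q ^ (12 * n)
          \<le> C * (4 * B / 2 ^ n) ^ 6 / q ^ (12 * n)"
        by (intro divide_right_mono) (auto simp: q_def)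
    qed
    also have "\<dots> = real (card (P n)) * (C * (4 * B / 2 ^ n) ^ 6 / q ^ (12 * n))"
      by (simp add: case_prod_unfold)
    also have "\<dots> \<le> 25 * (real A + 1)\<^sup>2 * 16 ^ n * (C * (4 * B / 2 ^ n) ^ 6 / q ^ (12 * n))"
      using B C by (intro mult_right_mono cardP) (auto simp: q_def)
    also have "\<dots> = K * (16 ^ n / ((2 ^ n) ^ 6 * q ^ (12 * n)))"
      by (simp add: K_def power_divide)
    also have "(2 ^ n) ^ 6 * q ^ (12 * n) = (64 * q ^ 12) ^ n"
    proof -
      have "((2::real) ^ n) ^ 6 = (2 ^ 6) ^ n" by (simp only: power_mult[symmetric] mult.commute)
      then show ?thesis by (simp add: power_mult_distrib power_mult)
    qed
    also have "16 ^ n / (64 * q ^ 12) ^ n = \<rho> ^ n"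
    proof -
      have "16 / (64 * q ^ 12) = \<rho>" by (simp add: \<rho>_def)
      then show ?thesis by (metis power_divide)
    qed
    finally show ?thesis .
  qed
  define E where "E n = {w \<in> space M. 1 \<le> G n w}" for n
  have [measurable]: "G n \<in> borel_measurable M" for n using Gint by auto
  have E: "E n \<in> sets M" for n unfolding E_def by measurable
  have "measure M (E n) \<le> K * \<rho> ^ n" for n
    using integral_Markov_inequality_measure[OF Gint sets.empty_sets, of n 1] Gpos GE[of n]
    by (simp add: E_def)
  then have "summable (\<lambda>n. measure M (E n))"
    by (intro summable_comparison_test[OF _ summable_mult[OF summable_geometric[of \<rho>], of K]])
      (use \<rho> in auto)
  then have "AE w in M. \<forall>\<^sub>F n in sequentially. w \<in> space M - E n"
    by (intro borel_cantelli_AE1 E) (auto simp: emeasure_eq_measure)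
  then show ?thesis
  proof (rule AE_mp, intro AE_I2 impI)
    fix w assume "\<forall>\<^sub>F n in sequentially. w \<in> space M - E n"
    then obtain n0 where n0: "\<And>n. n \<ge> n0 \<Longrightarrow> G n w < 1"
      unfolding eventually_sequentially E_def by force
    show "uniformly_continuous_on T (\<lambda>t. Z t w)"
    proof (rule chaining_uniformly_continuous[of R T B q n0])
      fix n a b
      assume n: "n0 \<le> n" and ab: "a \<in> R n \<union> R (Suc n)" "b \<in> R n \<union> R (Suc n)"
        "dist a b \<le> 4 * B / 2 ^ n"
      have "(a, b) \<in> P n" using ab by (auto simp: P_def Q_def)
      then have "(Z a w - Z b w) ^ 12 / q ^ (12 * n) \<le> G n w"
        unfolding G_def using P
        by (intro member_le_sum[of "(a, b)" "P n" "\<lambda>(a, b). (Z a w - Z b w) ^ 12 / q ^ (12 * n)", simplified])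
          (auto simp: q_def)
      then have "(Z a w - Z b w) ^ 12 / q ^ (12 * n) \<le> 1"
        using n0[OF n] by linarith
      then have "(Z a w - Z b w) ^ 12 \<le> q ^ (12 * n)"
        by (simp add: q_def divide_le_eq_1)
      then have "\<bar>Z a w - Z b w\<bar> ^ 12 \<le> (q ^ n) ^ 12"
        by (simp add: power_even_abs mult.commute flip: power_mult)
      then show "\<bar>Z a w - Z b w\<bar> \<le> q ^ n"
        by (rule power_le_imp_le_base[where n = 11, simplified]) (simp add: q_def)
    qed (use R net ex B in \<open>auto simp: q_def\<close>)
  qed
qed

text \<open>Near a point, uniform continuity on \<open>D\<close> confines the values on
  \<open>D\<close> to a small closed ball; separability, with that ball as the closed set, confines
  all values on \<open>T\<close>. The condition is local so that it also applies to paths on the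
  whole line.\<close>

lemma separable_path_continuous_on:
  fixes z :: "'i::metric_space \<Rightarrow> real"
  assumes sep: "\<And>I C t. open I \<Longrightarrow> closed C \<Longrightarrow> \<forall>t\<in>I \<inter> D. z t \<in> C \<Longrightarrow> t \<in> I \<inter> T \<Longrightarrow> z t \<in> C"
    and D: "D \<subseteq> T" "T \<subseteq> closure D"
    and uc: "\<And>t. t \<in> T \<Longrightarrow> \<exists>I. open I \<and> t \<in> I \<and> uniformly_continuous_on (I \<inter> D) z"
  shows "continuous_on T z"
  unfolding continuous_on_iff
proof (intro ballI allI impI)
  fix t :: 'i and e :: real assume t: "t \<in> T" and e: "0 < e"
  obtain I where I: "open I" "t \<in> I" "uniformly_continuous_on (I \<inter> D) z" using uc[OF t] by blast
  obtain r where r: "0 < r" "ball t r \<subseteq> I" using I by (meson open_contains_ball)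
  obtain \<delta> where \<delta>: "0 < \<delta>" and
    z: "\<And>a b. a \<in> I \<inter> D \<Longrightarrow> b \<in> I \<inter> D \<Longrightarrow> dist a b < \<delta> \<Longrightarrow> dist (z a) (z b) < e / 3"
    using uniformly_continuous_onE[OF I(3), of "e / 3"] e by (metis dist_commute zero_less_divide_iff zero_less_numeral)
  \<comment> \<open>With radius at most \<open>\<delta> / 2\<close>, any two points of
    \<open>J\<close> are less than \<delta> apart.\<close>
  define J where "J = ball t (min r (\<delta> / 2))"
  have J: "open J" "t \<in> J" "J \<subseteq> I" using r \<delta> by (auto simp: J_def)
  obtain a where a: "a \<in> J" "a \<in> D"
    using D(2) t J by (meson closure_iff_nhds_not_empty disjoint_iff order_refl subsetD)
  have "\<forall>b\<in>J \<inter> D. z b \<in> cball (z a) (e / 3)"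
  proof
    fix b assume b: "b \<in> J \<inter> D"
    have "dist a b < \<delta>" using a b dist_triangle_half_r[of t a \<delta> b] by (auto simp: J_def dist_commute)
    then show "z b \<in> cball (z a) (e / 3)" using z[of a b] a b J by (simp add: subset_eq less_imp_le)
  qed
  then have *: "z b \<in> cball (z a) (e / 3)" if "b \<in> J \<inter> T" for b
    using sep[OF J(1) closed_cball _ that] by blast
  show "\<exists>d>0. \<forall>x'\<in>T. dist x' t < d \<longrightarrow> dist (z x') (z t) < e"
  proof (intro exI[of _ "min r (\<delta> / 2)"] conjI ballI impI)
    fix x assume x: "x \<in> T" "dist x t < min r (\<delta> / 2)"
    then have "x \<in> J" by (auto simp: J_def dist_commute)
    then have "dist (z a) (z x) \<le> e / 3" "dist (z a) (z t) \<le> e / 3" using * x t J by auto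
    then show "dist (z x) (z t) < e" using e unfolding dist_real_def by linarith
  qed (use r \<delta> in auto)
qed

subsection \<open>Initial conditions\<close>

text \<open>Mean value inequality along one axis. The derivative hypothesis, stated at 0 for shifted
  functions as in \<open>bounded_partials_on\<close>, is translated to every point of the segment,
  which convexity keeps inside \<open>C\<close>.\<close>

lemma axis_increment_bound:
  fixes f :: "real^2 \<Rightarrow> real"
  assumes C: "convex C" "p \<in> C" "p + a *\<^sub>R axis i 1 \<in> C"
    and D: "\<And>q. q \<in> C \<Longrightarrow> \<exists>D. ((\<lambda>h. f (q + h *\<^sub>R axis i 1)) has_real_derivative D) (at 0) \<and> \<bar>D\<bar> \<le> B"
  shows "\<bar>f (p + a *\<^sub>R axis i 1) - f p\<bar> \<le> B * \<bar>a\<bar>"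
proof -
  define g where "g h = f (p + h *\<^sub>R axis i 1)" for h
  have "\<exists>D. (g has_real_derivative D) (at h) \<and> \<bar>D\<bar> \<le> B" if h: "h \<in> closed_segment 0 a" for h
  proof -
    obtain u where u: "0 \<le> u" "u \<le> 1" "h = u * a" using h by (auto simp: in_segment)
    have "p + h *\<^sub>R axis i 1 = (1 - u) *\<^sub>R p + u *\<^sub>R (p + a *\<^sub>R axis i 1)"
      by (simp add: u algebra_simps)
    also have "\<dots> \<in> C" using C u by (simp add: convex_alt)
    finally obtain D where "((\<lambda>k. f (p + h *\<^sub>R axis i 1 + k *\<^sub>R axis i 1)) has_real_derivative D) (at 0)" "\<bar>D\<bar> \<le> B"
      using assms(4) by blast
    then show ?thesis
      using DERIV_shift[of g D 0 h] by (auto simp: g_def algebra_simps intro!: exI[of _ D])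
  qed
  then obtain g' where g': "\<And>h. h \<in> closed_segment 0 a \<Longrightarrow> (g has_real_derivative g' h) (at h)"
    "\<And>h. h \<in> closed_segment 0 a \<Longrightarrow> \<bar>g' h\<bar> \<le> B" by metis
  have "norm (g a - g 0) \<le> B * norm (a - 0)"
    by (rule field_differentiable_bound[of "closed_segment 0 a" g g'])
      (use g' in \<open>auto intro: has_field_derivative_at_within\<close>)
  then show ?thesis by (simp add: g_def)
qed

text \<open>The expression is the variance of \<open>Z s - Z t\<close>. It splits into two
  increments of \<open>K\<close> in its second argument, with the first argument fixed at
  \<open>s\<close> and at \<open>t\<close>; each is linear in the distance.\<close>

lemma smooth_spatial_covariance_increment:
  assumes "compact S" and K: "smooth_spatial_covariance S K"
  obtains B r where "0 \<le> B" "0 < r"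
    "\<And>s t. s \<in> S \<Longrightarrow> t \<in> S \<Longrightarrow> dist s t < r \<Longrightarrow> \<bar>K s s - K s t - K t s + K t t\<bar> \<le> B * dist s t"
proof -
  obtain U B0 where U: "open U" "S \<subseteq> U"
    and D: "\<And>s u i. s \<in> U \<Longrightarrow> u \<in> U \<Longrightarrow>
      \<exists>D. ((\<lambda>h. K s (u + h *\<^sub>R axis i 1)) has_real_derivative D) (at 0) \<and> \<bar>D\<bar> \<le> B0"
    using K unfolding smooth_spatial_covariance_def bounded_partials_on_def by metis
  \<comment> \<open>Compactness gives one radius for all points of \<open>S\<close>. Paths can then
    run inside balls, which are convex and lie in \<open>U\<close>, although they may leave
    \<open>S\<close>.\<close>
  obtain r where r: "0 < r" "(\<Union>s\<in>S. ball s r) \<subseteq> U"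
    using compact_subset_open_imp_ball_epsilon_subset[OF assms(1) U] by blast
  define B where "B = max B0 0"
  have B: "0 \<le> B" by (simp add: B_def)
  have inc: "\<bar>K u t - K u s\<bar> \<le> 2 * B * dist s t"
    if u: "u \<in> S" and st: "s \<in> S" "dist s t < r" for u s t
  proof -
    \<comment> \<open>The corner of the path from \<open>s\<close> to \<open>t\<close> that changes
      the first coordinate and then the second; it stays in the ball because one coordinate
      difference is at most the distance.\<close>
    define m where "m = s + (t $ 1 - s $ 1) *\<^sub>R axis 1 1"
    have m: "t = m + (t $ 2 - s $ 2) *\<^sub>R axis 2 1"
      by (simp add: m_def vec_eq_iff forall_2 axis_def)
    have c: "\<bar>t $ i - s $ i\<bar> \<le> dist s t" for i
      using component_le_norm_cart[of "t - s" i] by (simp add: dist_norm norm_minus_commute)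
    have DB: "\<exists>D. ((\<lambda>h. K u (q + h *\<^sub>R axis i 1)) has_real_derivative D) (at 0) \<and> \<bar>D\<bar> \<le> B"
      if "q \<in> ball s r" for q i
      using D[of u q i] that u st U r unfolding B_def by (smt (verit) UN_I subsetD)
    have ms: "m \<in> ball s r"
      using c[of 1] st by (simp add: m_def dist_norm norm_axis_1)
    have "\<bar>K u m - K u s\<bar> \<le> B * \<bar>t $ 1 - s $ 1\<bar>"
      unfolding m_def by (rule axis_increment_bound[of "ball s r"])
        (use r DB ms in \<open>auto simp: m_def\<close>)
    also have "\<dots> \<le> B * dist s t" by (intro mult_left_mono c B)
    finally have 1: "\<bar>K u m - K u s\<bar> \<le> B * dist s t" .
    have "\<bar>K u (m + (t $ 2 - s $ 2) *\<^sub>R axis 2 1) - K u m\<bar> \<le> B * \<bar>t $ 2 - s $ 2\<bar>"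
      by (rule axis_increment_bound[of "ball s r"]) (use st DB ms m in auto)
    also have "\<dots> \<le> B * dist s t" by (intro mult_left_mono c B)
    finally have "\<bar>K u t - K u m\<bar> \<le> B * dist s t" using m by simp
    with 1 show ?thesis by linarith
  qed
  show ?thesis
  proof (rule that[of "4 * B" r])
    fix s t assume st: "s \<in> S" "t \<in> S" "dist s t < r"
    show "\<bar>K s s - K s t - K t s + K t t\<bar> \<le> 4 * B * dist s t"
      using inc[of s s t] inc[of t s t] st by linarith
  qed (use B r in auto)
qed

lemma centered_gaussian_process_continuous_on:
  fixes Z :: "real^2 \<Rightarrow> 'w \<Rightarrow> real"
  assumes M: "prob_space M" and S: "compact S"
    and Z: "centered_gaussian_process M S Z K" and K: "smooth_spatial_covariance S K"
    and sep: "separable_process M S Z"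
  shows "AE w in M. continuous_on S (\<lambda>s. Z s w)"
proof -
  obtain D where D: "countable D" "D \<subseteq> S" "S \<subseteq> closure D"
    and AE: "AE w in M. \<forall>I C. open I \<longrightarrow> closed C \<longrightarrow>
      (\<forall>t\<in>I \<inter> D. Z t w \<in> C) \<longrightarrow> (\<forall>t\<in>I \<inter> S. Z t w \<in> C)"
    using sep unfolding separable_process_def by blast
  obtain B r where B: "0 \<le> B" "0 < r"
    "\<And>s t. s \<in> S \<Longrightarrow> t \<in> S \<Longrightarrow> dist s t < r \<Longrightarrow> \<bar>K s s - K s t - K t s + K t t\<bar> \<le> B * dist s t"
    using smooth_spatial_covariance_increment[OF S K] by blast
  define c where "c = (fact 12 / (2 ^ 6 * fact 6) :: real)"
  have "bounded D" using D S bounded_subset compact_imp_bounded by blast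
  then have bd: "bounded ((\<lambda>s. s $ i) ` D)" for i
    unfolding bounded_iff by (force intro: order_trans[OF component_le_norm_cart])
  have "AE w in M. uniformly_continuous_on D (\<lambda>s. Z s w)"
  proof (rule kolmogorov_uniformly_continuous[OF M D(1) _ bd[of 1] bd[of 2] B(2), of "c * B ^ 6"])
    show "dist s t \<le> \<bar>s $ 1 - t $ 1\<bar> + \<bar>s $ 2 - t $ 2\<bar>" for s t :: "real^2"
      using norm_le_l1_cart[of "s - t"] by (simp add: dist_norm sum_2)
    show "0 \<le> c * B ^ 6" using B by (simp add: c_def)
    fix s t assume st: "s \<in> D" "t \<in> D" "dist s t < r"
    have "\<bar>K s s - K s t - K t s + K t t\<bar> \<le> B * dist s t" using B(3) st D by auto
    \<comment> \<open>The two-element type \<open>bool\<close> indexes the increment: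
      \<open>True\<close> carries \<open>s\<close> with weight 1, \<open>False\<close> carries
      \<open>t\<close> with weight -1.\<close>
    then have "integrable M (\<lambda>w. (\<Sum>i\<in>UNIV. (if i then 1 else - 1) * Z (if i then s else t) w) ^ 12)"
      "(LINT w|M. (\<Sum>i\<in>UNIV. (if i then 1 else - 1) * Z (if i then s else t) w) ^ 12) \<le> c * (B * dist s t) ^ 6"
      unfolding c_def
      by (intro gaussian_lincomb_moment_12[OF M Z]; use st D in \<open>auto simp: UNIV_bool algebra_simps\<close>)+
    then show "integrable M (\<lambda>w. (Z s w - Z t w) ^ 12)"
      "(LINT w|M. (Z s w - Z t w) ^ 12) \<le> c * B ^ 6 * dist s t ^ 6"
      by (simp_all add: UNIV_bool power_mult_distrib)
  qed
  then show ?thesis using AE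
  proof eventually_elim
    case (elim w)
    show ?case
      by (rule separable_path_continuous_on[OF _ D(2,3)])
        (use elim in \<open>auto intro!: exI[of _ UNIV]\<close>)
  qed
qed

section \<open>Continuity of the weight \<open>Mfun\<close>\<close>

text \<open>Uniform continuity on \<open>S \<times> S\<close> makes a small move of \<open>s\<close>
  change all competitors in the supremum by less than \<open>e / 2\<close> at once, hence the
  supremum by at most \<open>e / 2\<close>.\<close>

lemma continuous_on_Mfun:
  assumes "compact S"
  shows "continuous_on S (Mfun S)"
proof -
  define \<phi> where "\<phi> s u = (norm (sqv s - sqv u))\<^sup>2" for s u
  have "continuous_on (S \<times> S) (\<lambda>(s, u). \<phi> s u)"
    unfolding \<phi>_def sqv_def case_prod_unfold by (intro continuous_intros)
  then have uc: "uniformly_continuous_on (S \<times> S) (\<lambda>(s, u). \<phi> s u)"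
    using compact_Times[OF assms assms] by (rule compact_uniformly_continuous)
  have bdd: "bdd_above (\<phi> s ` S)" for s
  proof -
    have "continuous_on S (\<phi> s)" unfolding \<phi>_def sqv_def by (intro continuous_intros)
    then show ?thesis
      using assms by (intro bounded_imp_bdd_above compact_imp_bounded compact_continuous_image)
  qed
  have "continuous_on S (\<lambda>s. SUP u\<in>S. \<phi> s u)"
    unfolding continuous_on_iff
  proof (intro ballI allI impI)
    fix s and e :: real assume s: "s \<in> S" and e: "0 < e"
    obtain d where d: "0 < d" "\<And>p q. p \<in> S \<times> S \<Longrightarrow> q \<in> S \<times> S \<Longrightarrow> dist q p < d \<Longrightarrow>
        dist ((\<lambda>(s, u). \<phi> s u) q) ((\<lambda>(s, u). \<phi> s u) p) < e / 2"
      using uniformly_continuous_onE[OF uc, of "e / 2"] e half_gt_zero by metis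
    have le: "(SUP u\<in>S. \<phi> a u) \<le> (SUP u\<in>S. \<phi> b u) + e / 2"
      if ab: "a \<in> S" "b \<in> S" "dist a b < d" for a b
    proof (rule cSUP_least)
      fix u assume u: "u \<in> S"
      have "dist (\<phi> a u) (\<phi> b u) < e / 2"
        using d(2)[of "(b, u)" "(a, u)"] ab u by (simp add: dist_Pair_Pair)
      then have "\<phi> a u \<le> \<phi> b u + e / 2" unfolding dist_real_def by linarith
      also have "\<phi> b u \<le> (SUP u\<in>S. \<phi> b u)" by (rule cSUP_upper[OF u bdd])
      finally show "\<phi> a u \<le> (SUP u\<in>S. \<phi> b u) + e / 2" by simp
    qed (use ab in auto)
    show "\<exists>d>0. \<forall>t\<in>S. dist t s < d \<longrightarrow> dist (SUP u\<in>S. \<phi> t u) (SUP u\<in>S. \<phi> s u) < e"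
    proof (intro exI[of _ d] conjI ballI impI)
      fix t assume "t \<in> S" "dist t s < d"
      then show "dist (SUP u\<in>S. \<phi> t u) (SUP u\<in>S. \<phi> s u) < e"
        using le[of s t] le[of t s] s e by (simp add: dist_real_def dist_commute abs_le_iff)
    qed (use d in auto)
  qed
  then show ?thesis
    unfolding Mfun_def \<phi>_def by (intro continuous_on_exp)
qed

subsection \<open>Differentiability of the potential\<close>

definition diff_quot :: "(real \<Rightarrow> real) \<Rightarrow> real \<times> real \<Rightarrow> real" where
  "diff_quot v = (\<lambda>(x, h). (v (x + h) - v x) / h)"

text \<open>Both nodes \<open>x\<close> and \<open>x + h\<close> lie in \<open>D\<close>, so a
  countable \<open>D\<close> gives a countable index set; the bounds on \<open>x\<close> and
  \<open>h\<close> make it bounded, as nets require.\<close>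

definition diff_quot_domain :: "real set \<Rightarrow> real \<Rightarrow> (real \<times> real) set" where
  "diff_quot_domain D N = {(x, h). \<bar>x\<bar> < N \<and> \<bar>h\<bar> < 1 \<and> h \<noteq> 0 \<and> x \<in> D \<and> x + h \<in> D}"

text \<open>The point is that the line \<open>h = 0\<close>, where the derivative will be read off,
  belongs to the closure. Nodes in \<open>D\<close> are chosen near \<open>x\<close> and near
  \<open>x + h\<close>, kept distinct.\<close>

lemma closure_diff_quot_domain:
  assumes "closure D = UNIV"
  shows "{(x, h). \<bar>x\<bar> < N \<and> \<bar>h\<bar> < 1} \<subseteq> closure (diff_quot_domain D N)"
proof (clarify)
  fix x h :: real assume xh: "\<bar>x\<bar> < N" "\<bar>h\<bar> < 1"
  have dense: "\<exists>y\<in>D. a < y \<and> y < b" if "a < b" for a b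
  proof -
    have "(a + b) / 2 \<in> closure D" using assms by simp
    moreover have "0 < (b - a) / 2" using that by simp
    ultimately obtain y where "y \<in> D" "dist ((a + b) / 2) y < (b - a) / 2"
      using closure_approachableD by blast
    then show ?thesis unfolding dist_real_def by (intro bexI[of _ y]) (auto simp: abs_less_iff field_simps)
  qed
  show "(x, h) \<in> closure (diff_quot_domain D N)"
    unfolding closure_approachable
  proof (intro allI impI)
    fix e :: real assume e: "0 < e"
    \<comment> \<open>The first coordinate is off by less than \<open>d\<close> and the second by
      less than \<open>2 * d\<close>; the three bounds keep the total below \<open>e\<close> and the
      pair inside the strip.\<close>
    define d where "d = min (e / 4) (min ((N - \<bar>x\<bar>) / 2) ((1 - \<bar>h\<bar>) / 4))"
    have d: "0 < d" "d \<le> e / 4" "d \<le> (N - \<bar>x\<bar>) / 2" "d \<le> (1 - \<bar>h\<bar>) / 4"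
      unfolding d_def min_le_iff_disj using e xh by auto
    obtain y where y: "y \<in> D" "x < y" "y < x + d" using dense[of x "x + d"] d by auto
    obtain u where u: "u \<in> D" "x + h - d < u" "u < x + h + d" "u \<noteq> y"
    \<comment> \<open>Taking \<open>u\<close> on the side of \<open>x + h\<close> away from
      \<open>y\<close> ensures \<open>u \<noteq> y\<close>.\<close>
    proof (cases "y < x + h")
      case True
      then show ?thesis using dense[of "x + h" "x + h + d"] d that by force
    next
      case False
      then show ?thesis using dense[of "x + h - d" "x + h"] d that by force
    qed
    have "\<bar>y\<bar> < N" "\<bar>u - y\<bar> < 1" "\<bar>y - x\<bar> + \<bar>u - y - h\<bar> < e"
    proof -
      have *: "\<bar>y - x\<bar> < d" "\<bar>u - y - h\<bar> < 2 * d" using y u by (simp_all add: abs_less_iff)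
      then show "\<bar>y - x\<bar> + \<bar>u - y - h\<bar> < e" using d e by linarith
      have "\<bar>y\<bar> \<le> \<bar>x\<bar> + \<bar>y - x\<bar>" "\<bar>u - y\<bar> \<le> \<bar>h\<bar> + \<bar>u - y - h\<bar>" by simp_all
      moreover have "\<bar>x\<bar> + d < N" "\<bar>h\<bar> + 2 * d < 1" using d xh by (simp_all add: field_simps)
      ultimately show "\<bar>y\<bar> < N" "\<bar>u - y\<bar> < 1" using * by simp_all
    qed
    moreover have "dist (y, u - y) (x, h) \<le> \<bar>y - x\<bar> + \<bar>u - y - h\<bar>"
      unfolding dist_Pair_Pair dist_real_def by (rule sqrt_sum_squares_le_sum_abs[THEN order_trans]) simp
    ultimately show "\<exists>p\<in>diff_quot_domain D N. dist p (x, h) < e"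
      using y u by (intro bexI[of _ "(y, u - y)"]) (auto simp: diff_quot_domain_def)
  qed
qed

text \<open>The quotient extends continuously to the closed strip. Its extension \<open>g\<close>
  agrees with the quotient for all \<open>h \<noteq> 0\<close>, so \<open>g (x, 0)\<close> is the
  derivative, and continuity of \<open>g\<close> along \<open>h = 0\<close> is continuity of
  \<open>deriv v\<close>.\<close>

lemma C1_path_of_diff_quot:
  assumes sep: "\<And>I C t. open I \<Longrightarrow> closed C \<Longrightarrow> \<forall>t\<in>I \<inter> D. v t \<in> C \<Longrightarrow> t \<in> I \<Longrightarrow> v t \<in> C"
    and D: "closure D = UNIV"
    and uc: "\<And>N::nat. uniformly_continuous_on (diff_quot_domain D (real N)) (diff_quot v)"
  shows "continuous_on UNIV (deriv v)"
proof -
  have bdd: "bounded (diff_quot_domain D N)" for N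
    by (rule bounded_subset[of "cball 0 N \<times> cball 0 1"])
      (auto simp: diff_quot_domain_def intro!: bounded_Times)
  \<comment> \<open>First \<open>v\<close> itself: bounded quotients make it locally Lipschitz on
    \<open>D\<close>, and separability carries continuity to the line.\<close>
  have "continuous_on UNIV v"
  proof (rule separable_path_continuous_on[of D v UNIV])
    fix t :: real
    obtain N :: nat where N: "\<bar>t\<bar> + 1 < real N" using reals_Archimedean2 by blast
    obtain B where B: "0 < B" "\<And>p. p \<in> diff_quot_domain D N \<Longrightarrow> \<bar>diff_quot v p\<bar> \<le> B"
      using bounded_uniformly_continuous_image[OF uc[of N] bdd[of "real N"]] by (auto simp: bounded_pos)
    have "dist (v b) (v a) \<le> B * dist b a" if "a \<in> D" "b \<in> D" "dist t a < 1 / 2" "dist t b < 1 / 2" for a b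
    proof (cases "a = b")
      case False
      have "(a, b - a) \<in> diff_quot_domain D N"
        using that False N unfolding diff_quot_domain_def dist_real_def by (auto; linarith)
      from B(2)[OF this] show ?thesis
        using False by (simp add: diff_quot_def dist_real_def field_simps abs_divide)
    qed simp
    then have "B-lipschitz_on (ball t (1 / 2) \<inter> D) v"
      using B by (intro lipschitz_onI) (auto simp: dist_commute)
    then show "\<exists>I. open I \<and> t \<in> I \<and> uniformly_continuous_on (I \<inter> D) v"
      by (intro exI[of _ "ball t (1 / 2)"]) (auto intro: lipschitz_on_uniformly_continuous)
  qed (use sep D in auto)
  have "isCont (deriv v) x0" for x0
  proof -
    obtain N :: nat where N: "\<bar>x0\<bar> < real N" using reals_Archimedean2 by blast
    let ?E = "diff_quot_domain D (real N)"
    let ?O = "{(x, h). \<bar>x\<bar> < real N \<and> \<bar>h\<bar> < 1} :: (real \<times> real) set"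
    let ?Y = "{(x, h) \<in> ?O. h \<noteq> 0}"
    obtain g where g: "uniformly_continuous_on (closure ?E) g"
      and ext: "\<And>Y h x. ?E \<subseteq> Y \<Longrightarrow> Y \<subseteq> closure ?E \<Longrightarrow> continuous_on Y h \<Longrightarrow>
        (\<And>x. x \<in> ?E \<Longrightarrow> diff_quot v x = h x) \<Longrightarrow> x \<in> Y \<Longrightarrow> h x = g x"
      using uniformly_continuous_on_extension_on_closure[OF uc[of N]] by metis
    have contg: "continuous_on ?O g"
      using uniformly_continuous_imp_continuous[OF g] closure_diff_quot_domain[OF D]
      by (rule continuous_on_subset)
    have "continuous_on ?Y (diff_quot v)"
      unfolding diff_quot_def case_prod_unfold
      by (intro continuous_intros continuous_on_compose2[OF \<open>continuous_on UNIV v\<close>]) auto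
    \<comment> \<open>Uniqueness of the continuous extension: off \<open>h = 0\<close> the quotient
      of the continuous \<open>v\<close> is continuous, and it equals \<open>g\<close> on the dense
      set \<open>?E\<close>.\<close>
    then have gq: "diff_quot v p = g p" if "p \<in> ?Y" for p
      using that closure_diff_quot_domain[OF D, of "real N"]
      by (intro ext[of ?Y]) (auto simp: diff_quot_domain_def)
    have opO: "open ?O"
    proof -
      have "?O = {- real N<..<real N} \<times> {-1<..<1}" by auto
      then show ?thesis by (simp add: open_Times)
    qed
    have dv: "deriv v x = g (x, 0)" if x: "\<bar>x\<bar> < real N" for x
    proof (rule DERIV_imp_deriv)
      have "isCont g (x, 0)" using contg opO x by (simp add: continuous_on_eq_continuous_at)
      then have "isCont (\<lambda>h. g (x, h)) 0"
        by (intro isCont_o2[where f = "\<lambda>h. (x, h)" and g = g]) (auto intro!: continuous_intros)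
      then have "(\<lambda>h. g (x, h)) \<midarrow>0\<rightarrow> g (x, 0)" by (simp add: isCont_def)
      moreover have "\<forall>\<^sub>F h in at 0. g (x, h) = (v (x + h) - v x) / h"
        unfolding eventually_at using x gq
        by (intro exI[of _ 1]) (auto simp: diff_quot_def)
      ultimately show "(v has_field_derivative g (x, 0)) (at x)"
        unfolding DERIV_def by (simp add: tendsto_cong)
    qed
    have "isCont g (x0, 0)" using contg opO N by (simp add: continuous_on_eq_continuous_at)
    then have "isCont (\<lambda>x. g (x, 0)) x0"
      by (intro isCont_o2[where f = "\<lambda>x. (x, 0)" and g = g]) (auto intro!: continuous_intros)
    moreover have "\<forall>\<^sub>F x in nhds x0. deriv v x = g (x, 0)"
      using N by (intro eventually_mono[OF eventually_nhds_in_open[of "{- real N<..<real N}"]] dv) auto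
    ultimately show ?thesis by (subst isCont_cong)
  qed
  then show ?thesis by (simp add: continuous_on_eq_continuous_at)
qed

lemma diff_quot_variance_bound:
  fixes c :: "real \<Rightarrow> real \<Rightarrow> real" and x y h k :: real
  assumes c: "C2_plane c" and L: "L-lipschitz_on UNIV (\<lambda>(x, y). pd2 (pd1 c) x y)"
    and hk: "h \<noteq> 0" "k \<noteq> 0"
  \<comment> \<open>\<open>G t s\<close> is the covariance at \<open>t, s\<close> of \<open>t \<mapsto> V (x + t * h) / h - V (y + t * k) / k\<close>, whose increment
    over \<open>[0, 1]\<close> is the difference of the two quotients.  Applying the mean value theorem to this
    combination, rather than to each covariance separately, puts all four terms at the same \<open>\<tau>, \<sigma>\<close>.\<close>
  defines "G \<equiv> \<lambda>t s. c (x + t * h) (x + s * h) / h\<^sup>2 - c (x + t * h) (y + s * k) / (h * k)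
    - c (y + t * k) (x + s * h) / (h * k) + c (y + t * k) (y + s * k) / k\<^sup>2"
  shows "\<bar>G 1 1 - G 1 0 - G 0 1 + G 0 0\<bar> \<le> 4 * L * dist (x, h) (y, k)"
proof -
  have fd: "(\<lambda>z. c z b) field_differentiable at a" "(\<lambda>z. pd1 c a z) field_differentiable at b" for a b
    using c unfolding C2_plane_def C1_plane_def by auto
  have d1: "((\<lambda>t. c (a + t * m) b) has_real_derivative pd1 c (a + t * m) b * m) (at t)" for a b m t
  proof (rule DERIV_chain2[where f = "\<lambda>z. c z b" and g = "\<lambda>t. a + t * m"])
    show "((\<lambda>z. c z b) has_real_derivative pd1 c (a + t * m) b) (at (a + t * m))"
      using fd(1)[of b] by (simp add: pd1_def field_differentiable_derivI)
  qed (auto intro!: derivative_eq_intros)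
  have d2: "((\<lambda>s. pd1 c a (b + s * m)) has_real_derivative pd2 (pd1 c) a (b + s * m) * m) (at s)" for a b m s
  proof (rule DERIV_chain2[where f = "pd1 c a" and g = "\<lambda>s. b + s * m"])
    show "((\<lambda>z. pd1 c a z) has_real_derivative pd2 (pd1 c) a (b + s * m)) (at (b + s * m))"
      using fd(2)[of a] by (simp add: pd2_def field_differentiable_derivI)
  qed (auto intro!: derivative_eq_intros)
  \<comment> \<open>\<open>G1\<close> and \<open>G12\<close> are the derivatives of \<open>G\<close>
    in \<open>t\<close> and then in \<open>s\<close>; the chain rule factors \<open>h\<close> and
    \<open>k\<close> cancel all denominators, so small \<open>h\<close> and \<open>k\<close> do no
    harm.\<close>
  define G1 where "G1 t s = pd1 c (x + t * h) (x + s * h) / h - pd1 c (x + t * h) (y + s * k) / k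
    - pd1 c (y + t * k) (x + s * h) / h + pd1 c (y + t * k) (y + s * k) / k" for t s
  define G12 where "G12 t s = pd2 (pd1 c) (x + t * h) (x + s * h) - pd2 (pd1 c) (x + t * h) (y + s * k)
    - pd2 (pd1 c) (y + t * k) (x + s * h) + pd2 (pd1 c) (y + t * k) (y + s * k)" for t s
  have D1: "((\<lambda>t. G t s) has_real_derivative G1 t s) (at t)" for t s
    unfolding G_def
    by (rule DERIV_cong[OF DERIV_add[OF DERIV_diff[OF DERIV_diff[OF DERIV_cdivide DERIV_cdivide]
          DERIV_cdivide] DERIV_cdivide]], (rule d1)+)
      (use hk in \<open>simp add: G1_def power2_eq_square\<close>)
  have D2: "((\<lambda>s. G1 t s) has_real_derivative G12 t s) (at s)" for t s
    unfolding G1_def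
    by (rule DERIV_cong[OF DERIV_add[OF DERIV_diff[OF DERIV_diff[OF DERIV_cdivide DERIV_cdivide]
          DERIV_cdivide] DERIV_cdivide]], (rule d2)+)
      (use hk in \<open>simp add: G12_def\<close>)
  have "\<exists>\<tau>>0. \<tau> < 1 \<and> (G 1 1 - G 1 0) - (G 0 1 - G 0 0) = (1 - 0) * (G1 \<tau> 1 - G1 \<tau> 0)"
    by (rule MVT2) (auto intro!: DERIV_diff D1)
  then obtain \<tau> where 1: "(G 1 1 - G 1 0) - (G 0 1 - G 0 0) = G1 \<tau> 1 - G1 \<tau> 0" by auto
  have "\<exists>\<sigma>>0. \<sigma> < 1 \<and> G1 \<tau> 1 - G1 \<tau> 0 = (1 - 0) * G12 \<tau> \<sigma>"
    by (rule MVT2) (auto intro!: D2)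
  then obtain \<sigma> where \<sigma>: "0 < \<sigma>" "\<sigma> < 1" and 2: "G1 \<tau> 1 - G1 \<tau> 0 = G12 \<tau> \<sigma>" by auto
  have lip: "\<bar>pd2 (pd1 c) a b - pd2 (pd1 c) a b'\<bar> \<le> L * \<bar>b - b'\<bar>" for a b b'
    using lipschitz_onD[OF L, of "(a, b)" "(a, b')"] by (simp add: dist_Pair_Pair dist_real_def)
  have L0: "0 \<le> L" using L by (rule lipschitz_on_nonneg)
  have "\<bar>x + \<sigma> * h - (y + \<sigma> * k)\<bar> = \<bar>(x - y) + \<sigma> * (h - k)\<bar>" by (simp add: algebra_simps)
  also have "\<dots> \<le> \<bar>x - y\<bar> + \<bar>\<sigma> * (h - k)\<bar>" by (rule abs_triangle_ineq)
  also have "\<bar>\<sigma> * (h - k)\<bar> \<le> 1 * \<bar>h - k\<bar>" unfolding abs_mult using \<sigma> by (intro mult_right_mono) auto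
  also have "\<bar>x - y\<bar> \<le> dist (x, h) (y, k)"
    using dist_fst_le[of "(x, h)" "(y, k)"] by (simp add: dist_real_def)
  also have "1 * \<bar>h - k\<bar> \<le> dist (x, h) (y, k)"
    using dist_snd_le[of "(x, h)" "(y, k)"] by (simp add: dist_real_def)
  finally have "\<bar>x + \<sigma> * h - (y + \<sigma> * k)\<bar> \<le> 2 * dist (x, h) (y, k)" by simp
  then have "L * \<bar>x + \<sigma> * h - (y + \<sigma> * k)\<bar> \<le> L * (2 * dist (x, h) (y, k))"
    using L0 by (rule mult_left_mono)
  \<comment> \<open>The four terms form two pairs with a common first argument, each controlled by
    the Lipschitz bound in the second; two pairs times the factor 2 above give the constant
    4.\<close>
  moreover have "\<bar>G12 \<tau> \<sigma>\<bar> \<le> 2 * (L * \<bar>x + \<sigma> * h - (y + \<sigma> * k)\<bar>)"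
    using lip[of "x + \<tau> * h" "x + \<sigma> * h" "y + \<sigma> * k"] lip[of "y + \<tau> * k" "x + \<sigma> * h" "y + \<sigma> * k"]
    unfolding G12_def by linarith
  ultimately show ?thesis using 1 2 by linarith
qed

lemma centered_gaussian_process_C1:
  assumes M: "prob_space M"
    and V: "centered_gaussian_process M UNIV V c" and c: "C2_plane c" "lipschitz_mixed_partials c"
    and sep: "separable_process M UNIV V"
  shows "AE w in M. continuous_on UNIV (deriv (\<lambda>x. V x w))"
proof -
  obtain D :: "real set" where D: "countable D" "closure D = UNIV"
    and AE: "AE w in M. \<forall>I C. open I \<longrightarrow> closed C \<longrightarrow>
      (\<forall>t\<in>I \<inter> D. V t w \<in> C) \<longrightarrow> (\<forall>t\<in>I \<inter> UNIV. V t w \<in> C)"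
    using sep unfolding separable_process_def by blast
  obtain L where L: "L-lipschitz_on UNIV (\<lambda>(x, y). pd2 (pd1 c) x y)"
    using c(2) unfolding lipschitz_mixed_partials_def by blast
  have L0: "0 \<le> L" using L by (rule lipschitz_on_nonneg)
  define \<kappa> where "\<kappa> = (fact 12 / (2 ^ 6 * fact 6) :: real)"
  have "AE w in M. uniformly_continuous_on (diff_quot_domain D N) (\<lambda>p. diff_quot (\<lambda>x. V x w) p)" for N
  \<comment> \<open>The variance bound holds at every distance, so \<open>r = 1\<close> is an
    arbitrary choice.\<close>
  proof (rule kolmogorov_uniformly_continuous[OF M, where f = fst and g = snd and r = 1 and C = "\<kappa> * (4 * L) ^ 6"])
    have "diff_quot_domain D N \<subseteq> (\<lambda>(x, u). (x, u - x)) ` (D \<times> D)"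
      by (force simp: diff_quot_domain_def image_iff)
    then show "countable (diff_quot_domain D N)"
      using D(1) by (meson countable_SIGMA countable_image countable_subset)
    show "dist p q \<le> \<bar>fst p - fst q\<bar> + \<bar>snd p - snd q\<bar>" for p q :: "real \<times> real"
      using sqrt_sum_squares_le_sum_abs[of "fst p - fst q" "snd p - snd q"]
      by (simp add: dist_prod_def dist_real_def)
    show "bounded (fst ` diff_quot_domain D N)" "bounded (snd ` diff_quot_domain D N)"
      unfolding bounded_iff diff_quot_domain_def
      by (intro exI[of _ N], force) (intro exI[of _ 1], force)
    show "0 \<le> \<kappa> * (4 * L) ^ 6" using L0 by (simp add: \<kappa>_def)
    fix p q :: "real \<times> real"
    assume pq: "p \<in> diff_quot_domain D N" "q \<in> diff_quot_domain D N"
    obtain x h y k where p: "p = (x, h)" and q: "q = (y, k)" by fastforce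
    have hk: "h \<noteq> 0" "k \<noteq> 0" using pq by (auto simp: p q diff_quot_domain_def)
    define a where "a i = [1 / h, - 1 / h, - 1 / k, 1 / k] ! i" for i
    define z where "z i = [x + h, x, y + k, y] ! i" for i
    have I: "{..<4} = {0, 1, 2, 3 :: nat}" by auto
    have sum: "(\<Sum>i<4. a i * V (z i) w) = diff_quot (\<lambda>x. V x w) p - diff_quot (\<lambda>x. V x w) q" for w
      unfolding I by (simp add: a_def z_def diff_quot_def p q diff_divide_distrib)
    \<comment> \<open>The factors 1 and 0 are left in to display the form as the mixed difference of
      \<open>G\<close> over the corners of the unit square.\<close>
    have "(\<Sum>i<4. \<Sum>j<4. a i * a j * c (z i) (z j)) =
        (c (x + 1 * h) (x + 1 * h) / h\<^sup>2 - c (x + 1 * h) (y + 1 * k) / (h * k)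
          - c (y + 1 * k) (x + 1 * h) / (h * k) + c (y + 1 * k) (y + 1 * k) / k\<^sup>2)
        - (c (x + 1 * h) (x + 0 * h) / h\<^sup>2 - c (x + 1 * h) (y + 0 * k) / (h * k)
          - c (y + 1 * k) (x + 0 * h) / (h * k) + c (y + 1 * k) (y + 0 * k) / k\<^sup>2)
        - (c (x + 0 * h) (x + 1 * h) / h\<^sup>2 - c (x + 0 * h) (y + 1 * k) / (h * k)
          - c (y + 0 * k) (x + 1 * h) / (h * k) + c (y + 0 * k) (y + 1 * k) / k\<^sup>2)
        + (c (x + 0 * h) (x + 0 * h) / h\<^sup>2 - c (x + 0 * h) (y + 0 * k) / (h * k)
          - c (y + 0 * k) (x + 0 * h) / (h * k) + c (y + 0 * k) (y + 0 * k) / k\<^sup>2)"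
      unfolding I by (simp add: a_def z_def power2_eq_square mult.commute)
    then have "\<bar>\<Sum>i<4. \<Sum>j<4. a i * a j * c (z i) (z j)\<bar> \<le> 4 * L * dist p q"
      using diff_quot_variance_bound[OF c(1) L hk, of x y] by (simp only: p q)
    from gaussian_lincomb_moment_12[OF M V _ _ this]
    show "integrable M (\<lambda>w. (diff_quot (\<lambda>x. V x w) p - diff_quot (\<lambda>x. V x w) q) ^ 12)"
      "(LINT w|M. (diff_quot (\<lambda>x. V x w) p - diff_quot (\<lambda>x. V x w) q) ^ 12)
        \<le> \<kappa> * (4 * L) ^ 6 * dist p q ^ 6"
      unfolding sum \<kappa>_def by (simp_all add: power_mult_distrib mult.assoc)
  qed simp
  then have "AE w in M. \<forall>N::nat. uniformly_continuous_on (diff_quot_domain D N) (diff_quot (\<lambda>x. V x w))"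
    by (simp add: AE_all_countable)
  then show ?thesis using AE
  proof eventually_elim
    case (elim w)
    show ?case
      by (rule C1_path_of_diff_quot[OF _ D(2)]) (use elim in auto)
  qed
qed

subsection \<open>Continuity at later times\<close>

theorem theorem2p2:
  fixes M :: "'w measure"
    and S :: "(real^2) set"
    and X Y :: "real^2 \<Rightarrow> real \<Rightarrow> 'w \<Rightarrow> real"
    and V :: "real \<Rightarrow> 'w \<Rightarrow> real"
    and Kx Ky :: "real^2 \<Rightarrow> real^2 \<Rightarrow> real"
    and cv :: "real \<Rightarrow> real \<Rightarrow> real"
    and dt \<alpha> \<beta> :: real
  assumes "prob_space M"
    and "compact S" and "\<exists>a b. 0 < measure lborel (cbox a b) \<and> cbox a b \<subseteq> S"
    and "0 < dt" and "\<bar>\<alpha>\<bar> < 1" and "\<bar>\<beta>\<bar> < 1"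
    and A1_X: "centered_gaussian_process M S (\<lambda>s. X s 0) Kx" "smooth_spatial_covariance S Kx"
    and A1_Y: "centered_gaussian_process M S (\<lambda>s. Y s 0) Ky" "smooth_spatial_covariance S Ky"
    and A2: "centered_gaussian_process M UNIV V cv" "C2_plane cv" "lipschitz_mixed_partials cv"
    and separable: "separable_process M S (\<lambda>s. X s 0)" "separable_process M S (\<lambda>s. Y s 0)"
      "separable_process M UNIV V"
    and "dynamics M S dt \<alpha> \<beta> V X Y"
  shows "\<forall>h::nat\<ge>1.
    (AE w in M. continuous_on S (\<lambda>s. Y s (real h * dt) w)) \<and>
    (AE w in M. continuous_on S (\<lambda>s. X s (real h * dt) w))"
proof -
  \<comment> \<open>One null set serves all times: outside it the initial data and \<open>V'\<close>
    are continuous, and the induction on \<open>h\<close> is deterministic. \<open>AE_space\<close>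
    supplies the points at which \<open>dynamics\<close> speaks.\<close>
  have "AE w in M. \<forall>h::nat. continuous_on S (\<lambda>s. Y s (real h * dt) w) \<and>
      continuous_on S (\<lambda>s. X s (real h * dt) w)"
    using centered_gaussian_process_continuous_on[OF assms(1,2) A1_X separable(1)]
      centered_gaussian_process_continuous_on[OF assms(1,2) A1_Y separable(2)]
      centered_gaussian_process_C1[OF assms(1) A2 separable(3)] AE_space[of M]
  proof eventually_elim
    case (elim w)
    define v where "v = deriv (\<lambda>x. V x w)"
    have v: "continuous_on S (\<lambda>s. v (f s))" if "continuous_on S f" for f :: "real^2 \<Rightarrow> real"
      using continuous_on_compose2[OF elim(3) that] by (simp add: v_def)
    have Mfun: "continuous_on S (\<lambda>s. dt / Mfun S s)"
      by (intro continuous_intros continuous_on_Mfun assms(2)) (simp add: Mfun_def)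
    have step: "Y s (real (Suc h) * dt) w = \<beta> * Y s (real h * dt) w
          + dt / Mfun S s * (\<alpha> * X s (real h * dt) w - dt / 2 * v (Y s (real h * dt) w))"
        "X s (real (Suc h) * dt) w = \<alpha>\<^sup>2 * X s (real h * dt) w
          - dt / 2 * (\<alpha> * v (Y s (real h * dt) w) + v (Y s (real (Suc h) * dt) w))"
      if "s \<in> S" for s h
      using assms(17) elim(4) that unfolding dynamics_def Let_def v_def by blast+
    show ?case
    proof
      fix h :: nat
      show "continuous_on S (\<lambda>s. Y s (real h * dt) w) \<and> continuous_on S (\<lambda>s. X s (real h * dt) w)"
      proof (induction h)
        case 0
        then show ?case using elim by simp
      next
        case (Suc h)
        \<comment> \<open>\<open>Y\<close> comes first, because the update of \<open>X\<close>
          evaluates \<open>V'\<close> at the new value of \<open>Y\<close>.\<close>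
        have Y: "continuous_on S (\<lambda>s. Y s (real (Suc h) * dt) w)"
          by (rule continuous_on_eq[OF _ step(1)[symmetric]], intro continuous_intros Mfun v)
            (use Suc in auto)
        moreover have "continuous_on S (\<lambda>s. X s (real (Suc h) * dt) w)"
          by (rule continuous_on_eq[OF _ step(2)[symmetric]], intro continuous_intros v Y)
            (use Suc in auto)
        ultimately show ?case ..
      qed
    qed
  qed
  then show ?thesis by (auto simp: AE_all_countable)
qed

end
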